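(* Let $M\subset\mathbb{R}^n$ be an $f$-eikonal helix submanifold (with respect to a unit direction $d\in\mathbb{R}^n$ and an eikonal function $f:M\to\mathbb{R}$). Then the helix lines of $M$ (with respect to $d$) are $f$-eikonal helix curves.
   Context: All objects are smooth; submanifolds $M\subset\mathbb{R}^n$ carry the induced metric. $M$ is a helix submanifold with respect to the unit vector $d\in\mathbb{R}^n$ if the angle between $d$ and $T_qM$ is the same for all $q\in M$; then along $M$ one writes $d=\cos(\theta)T^*+\sin(\theta)\xi$ with $T^*$ a unit tangent field, $\xi$ a unit normal field, and $\theta$ constant, where it is assumed throughout that $0<\theta<\frac{\pi}{2}$. The helix lines of $M$ with respect to $d$ are the integral curves of $T^*$ (so they have unit speed). $\nabla f$ is the gradient of $f$ on $M$; $f:M\to\mathbb{R}$ is eikonal if $\|\nabla f\|$ is constant. A helix submanifold $M$ with respect to $d$ with an eikonal function $f:M\to\mathbb{R}$ is an $f$-eikonal helix submanifold if the angle between $\nabla f$ and $d$ is constant on $M$, i.e. (since $\|\nabla f\|$ is constant and $d$ is unit) $\langle\nabla f,d\rangle$ is constant on $M$. A curve $\alpha:I\to M$ with unit tangent $T$, such that $\|\nabla f\|$ is constant along $\alpha$, is an $f$-eikonal helix curve if the angle between $\nabla f$ and $T$ is constant along $\alpha$, i.e. $\langle\nabla f,T\rangle$ is constant along $\alpha$. *)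

theory Defs
  imports "HOL-Analysis.Analysis"
begin

section \<open>Smooth maps\<close>

text \<open>Only meant for open sets: the derivatives are taken in the ambient space.\<close>

primrec Ck_on :: "nat \<Rightarrow> 'a::euclidean_space set \<Rightarrow> ('a \<Rightarrow> 'b::euclidean_space) \<Rightarrow> bool" where
  "Ck_on 0 U g \<longleftrightarrow> continuous_on U g"
| "Ck_on (Suc k) U g \<longleftrightarrow>
     (\<forall>x\<in>U. g differentiable (at x)) \<and>
     (\<forall>v. Ck_on k U (\<lambda>x. frechet_derivative g (at x) v))"

definition smooth_on :: "'a::euclidean_space set \<Rightarrow> ('a \<Rightarrow> 'b::euclidean_space) \<Rightarrow> bool" where
  "smooth_on U g \<longleftrightarrow> (\<forall>k. Ck_on k U g)"


section \<open>Submanifolds of Euclidean space\<close>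

text \<open>Embedded submanifolds of dimension \<open>k\<close>, by slice charts. The model subspace \<open>S\<close> is an
  arbitrary \<open>k\<close>-dimensional linear subspace instead of the span of the first \<open>k\<close> basis vectors;
  a linear change of coordinates passes from one to the other.\<close>

definition submanifold :: "nat \<Rightarrow> 'a::euclidean_space set \<Rightarrow> bool" where
  "submanifold k M \<longleftrightarrow>
     (\<forall>p\<in>M. \<exists>U V (\<psi> :: 'a \<Rightarrow> 'a) \<phi> S. open U \<and> p \<in> U \<and> open V \<and>
        homeomorphism U V \<psi> \<phi> \<and> smooth_on U \<psi> \<and> smooth_on V \<phi> \<and>
        subspace S \<and> dim S = k \<and> \<psi> ` (M \<inter> U) = V \<inter> S)"

definition curve_through :: "'a::euclidean_space set \<Rightarrow> 'a \<Rightarrow> (real \<Rightarrow> 'a) \<Rightarrow> 'a \<Rightarrow> bool" where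
  "curve_through M p \<gamma> v \<longleftrightarrow>
     (\<exists>\<epsilon>>0. smooth_on {-\<epsilon><..<\<epsilon>} \<gamma> \<and> \<gamma> ` {-\<epsilon><..<\<epsilon>} \<subseteq> M) \<and>
     \<gamma> 0 = p \<and> (\<gamma> has_vector_derivative v) (at 0)"

definition tangent_space :: "'a::euclidean_space set \<Rightarrow> 'a \<Rightarrow> 'a set" where
  "tangent_space M p = {v. \<exists>\<gamma>. curve_through M p \<gamma> v}"

text \<open>A function on \<open>M\<close> is represented by a function on the ambient space of which only the
  values on \<open>M\<close> matter; it is smooth if it extends smoothly near every point of \<open>M\<close>.\<close>

definition smooth_fun_on :: "'a::euclidean_space set \<Rightarrow> ('a \<Rightarrow> real) \<Rightarrow> bool" where
  "smooth_fun_on M f \<longleftrightarrow>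
     (\<forall>p\<in>M. \<exists>U g. open U \<and> p \<in> U \<and> smooth_on U g \<and> (\<forall>x\<in>M \<inter> U. f x = g x))"

text \<open>The gradient for the induced metric: the tangent vector \<open>w\<close> at \<open>p\<close> such that
  \<open>df\<^sub>p(v) = w \<bullet> v\<close> for every tangent vector \<open>v\<close>, where \<open>df\<^sub>p(v)\<close> is the derivative of \<open>f\<close> along any
  curve in \<open>M\<close> with velocity \<open>v\<close> at \<open>p\<close>.\<close>

definition gradient :: "'a::euclidean_space set \<Rightarrow> ('a \<Rightarrow> real) \<Rightarrow> 'a \<Rightarrow> 'a" where
  "gradient M f p =
     (THE w. w \<in> tangent_space M p \<and>
        (\<forall>\<gamma> v. curve_through M p \<gamma> v \<longrightarrow>
           ((\<lambda>t. f (\<gamma> t)) has_real_derivative (w \<bullet> v)) (at 0)))"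


section \<open>Angles\<close>

text \<open>Division by zero makes the angle with the zero vector equal to \<open>\<pi>/2\<close>.\<close>

definition vec_angle :: "'a::euclidean_space \<Rightarrow> 'a \<Rightarrow> real" where
  "vec_angle u v = arccos ((u \<bullet> v) / (norm u * norm v))"

text \<open>The closest point of a linear subspace is the orthogonal projection; if the projection is
  zero, the angle is \<open>\<pi>/2\<close> by the convention above, as it should be.\<close>

definition subspace_angle :: "'a::euclidean_space \<Rightarrow> 'a set \<Rightarrow> real" where
  "subspace_angle d S = vec_angle d (closest_point S d)"


section \<open>Helix submanifolds and eikonal functions\<close>

definition helix_submanifold :: "nat \<Rightarrow> 'a::euclidean_space set \<Rightarrow> 'a \<Rightarrow> real \<Rightarrow> bool" where
  "helix_submanifold k M d \<theta> \<longleftrightarrow>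
     submanifold k M \<and> norm d = 1 \<and> 0 < \<theta> \<and> \<theta> < pi / 2 \<and>
     (\<forall>q\<in>M. subspace_angle d (tangent_space M q) = \<theta>)"

text \<open>On a helix submanifold of angle \<open>\<theta>\<close> such fields \<open>T\<close> and \<open>\<xi>\<close> exist and their values on \<open>M\<close> are
  uniquely determined: \<open>cos \<theta> T\<close> and \<open>sin \<theta> \<xi>\<close> are the tangential and normal components of \<open>d\<close>.\<close>

definition helix_decomposition ::
  "'a::euclidean_space set \<Rightarrow> 'a \<Rightarrow> real \<Rightarrow> ('a \<Rightarrow> 'a) \<Rightarrow> ('a \<Rightarrow> 'a) \<Rightarrow> bool" where
  "helix_decomposition M d \<theta> T \<xi> \<longleftrightarrow>
     (\<forall>q\<in>M. T q \<in> tangent_space M q \<and> norm (T q) = 1 \<and>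
        (\<forall>v\<in>tangent_space M q. orthogonal (\<xi> q) v) \<and> norm (\<xi> q) = 1 \<and>
        d = cos \<theta> *\<^sub>R T q + sin \<theta> *\<^sub>R \<xi> q)"

definition smooth_curve_in :: "'a::euclidean_space set \<Rightarrow> real set \<Rightarrow> (real \<Rightarrow> 'a) \<Rightarrow> bool" where
  "smooth_curve_in M I \<alpha> \<longleftrightarrow> open I \<and> is_interval I \<and> smooth_on I \<alpha> \<and> \<alpha> ` I \<subseteq> M"

definition integral_curve ::
  "'a::euclidean_space set \<Rightarrow> ('a \<Rightarrow> 'a) \<Rightarrow> real set \<Rightarrow> (real \<Rightarrow> 'a) \<Rightarrow> bool" where
  "integral_curve M X I \<alpha> \<longleftrightarrow>
     smooth_curve_in M I \<alpha> \<and> (\<forall>t\<in>I. (\<alpha> has_vector_derivative X (\<alpha> t)) (at t))"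

definition helix_line ::
  "'a::euclidean_space set \<Rightarrow> 'a \<Rightarrow> real \<Rightarrow> real set \<Rightarrow> (real \<Rightarrow> 'a) \<Rightarrow> bool" where
  "helix_line M d \<theta> I \<alpha> \<longleftrightarrow>
     (\<exists>T \<xi>. helix_decomposition M d \<theta> T \<xi> \<and> integral_curve M T I \<alpha>)"

definition eikonal :: "'a::euclidean_space set \<Rightarrow> ('a \<Rightarrow> real) \<Rightarrow> bool" where
  "eikonal M f \<longleftrightarrow> smooth_fun_on M f \<and> (\<lambda>q. norm (gradient M f q)) constant_on M"

definition eikonal_helix_submanifold ::
  "nat \<Rightarrow> 'a::euclidean_space set \<Rightarrow> 'a \<Rightarrow> real \<Rightarrow> ('a \<Rightarrow> real) \<Rightarrow> bool" where
  "eikonal_helix_submanifold k M d \<theta> f \<longleftrightarrow>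
     helix_submanifold k M d \<theta> \<and> eikonal M f \<and>
     (\<lambda>q. vec_angle (gradient M f q) d) constant_on M"

definition eikonal_helix_curve ::
  "'a::euclidean_space set \<Rightarrow> ('a \<Rightarrow> real) \<Rightarrow> real set \<Rightarrow> (real \<Rightarrow> 'a) \<Rightarrow> bool" where
  "eikonal_helix_curve M f I \<alpha> \<longleftrightarrow>
     smooth_curve_in M I \<alpha> \<and> (\<forall>t\<in>I. norm (vector_derivative \<alpha> (at t)) = 1) \<and>
     (\<lambda>t. norm (gradient M f (\<alpha> t))) constant_on I \<and>
     (\<lambda>t. vec_angle (gradient M f (\<alpha> t)) (vector_derivative \<alpha> (at t))) constant_on I"

end

theory Submission
  imports Defs
begin

text \<open>In a slice chart the tangent space is the image of the model subspace under the
  differential of the inverse chart, hence a linear subspace. So the differential of a smooth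
  function is represented by a unique tangent vector, and \<open>gradient\<close> really is tangent. Pairing
  \<open>d = cos \<theta> T + sin \<theta> \<xi>\<close> with it kills the normal part: \<open>\<nabla>f \<bullet> d = cos \<theta> (\<nabla>f \<bullet> T)\<close>, so the angle
  of \<open>\<nabla>f\<close> with \<open>T\<close> is a function of its angle with \<open>d\<close>.\<close>

section \<open>Smoothness along lines, chain rule, velocities in a subspace\<close>

lemma Ck_on_cong:
  assumes "open U" "\<And>x. x \<in> U \<Longrightarrow> g x = h x" "Ck_on k U g"
  shows "Ck_on k U h"
  using assms
proof (induction k arbitrary: g h)
  case 0
  then show ?case by (simp cong: continuous_on_cong)
next
  case (Suc k)
  \<comment> \<open>Two maps agreeing on an open set have the same derivative at each of its points,
    so the induction hypothesis applies to the first derivatives.\<close>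
  have D: "(h has_derivative frechet_derivative g (at x)) (at x)" if "x \<in> U" for x
  proof (rule has_derivative_transform_within_open[OF _ \<open>open U\<close> that Suc.prems(2)])
    show "(g has_derivative frechet_derivative g (at x)) (at x)"
      using Suc.prems(3) that by (simp add: frechet_derivative_works[symmetric])
  qed
  have "Ck_on k U (\<lambda>x. frechet_derivative h (at x) v)" for v
  proof (rule Suc.IH[OF \<open>open U\<close>])
    show "Ck_on k U (\<lambda>x. frechet_derivative g (at x) v)" using Suc.prems by simp
  qed (simp add: frechet_derivative_at[OF D, symmetric])
  then show ?case using D by (auto simp: differentiable_def)
qed

lemma smooth_on_has_derivative:
  assumes "smooth_on U g" "x \<in> U"
  shows "(g has_derivative frechet_derivative g (at x)) (at x)"
proof -
  have "Ck_on (Suc 0) U g" using assms unfolding smooth_on_def by blast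
  then show ?thesis using assms(2) by (simp add: frechet_derivative_works[symmetric])
qed

text \<open>Supplies the smoothness of the curves that witness tangent vectors. An affine line has
  constant velocity, so differentiating the composite gives a directional derivative of
  \<open>g\<close> in a fixed direction, restricted to the same line: the induction closes without a
  product rule.\<close>

lemma Ck_on_compose_line:
  fixes g :: "'a::euclidean_space \<Rightarrow> 'b::euclidean_space"
  assumes "Ck_on k V g" "open J" "\<And>t. t \<in> J \<Longrightarrow> x + t *\<^sub>R w \<in> V"
  shows "Ck_on k J (\<lambda>t::real. g (x + t *\<^sub>R w))"
  using assms
proof (induction k arbitrary: g)
  case 0
  then show ?case
    by (auto intro!: continuous_intros continuous_on_compose2[of V g])
next
  case (Suc k)
  have D: "((\<lambda>t. g (x + t *\<^sub>R w)) has_derivative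
      (\<lambda>s. frechet_derivative g (at (x + t *\<^sub>R w)) (s *\<^sub>R w))) (at t)" if "t \<in> J" for t
  proof (rule has_derivative_compose[where f="\<lambda>t. x + t *\<^sub>R w"])
    show "((\<lambda>t. x + t *\<^sub>R w) has_derivative (\<lambda>s. s *\<^sub>R w)) (at t)"
      by (auto intro!: derivative_eq_intros)
    show "(g has_derivative frechet_derivative g (at (x + t *\<^sub>R w))) (at (x + t *\<^sub>R w))"
      using Suc.prems(1) Suc.prems(3)[OF that] by (simp add: frechet_derivative_works[symmetric])
  qed
  have "Ck_on k J (\<lambda>t. frechet_derivative (\<lambda>t. g (x + t *\<^sub>R w)) (at t) v)" for v
  proof (rule Ck_on_cong[OF \<open>open J\<close>])
    show "Ck_on k J (\<lambda>t. frechet_derivative g (at (x + t *\<^sub>R w)) (v *\<^sub>R w))"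
      using Suc.prems by (intro Suc.IH) auto
  qed (simp add: frechet_derivative_at[OF D, symmetric])
  then show ?case using D by (auto simp: differentiable_def)
qed

lemma has_vector_derivative_compose_frechet:
  assumes "(c has_vector_derivative v) (at t)" "(g has_derivative D) (at (c t))"
  shows "((\<lambda>t. g (c t)) has_vector_derivative D v) (at t)"
  using vector_derivative_diff_chain_within[OF assms(1) has_derivative_at_withinI[OF assms(2)]]
  by (simp add: o_def)

text \<open>The velocity is a limit of difference quotients, which lie in \<open>S\<close> for small
  nonzero \<open>t\<close>, and a subspace of a Euclidean space is closed. The filter
  \<open>nhds 0\<close>, unlike \<open>at 0\<close>, also puts \<open>c 0\<close> into
  \<open>S\<close>.\<close>

lemma has_vector_derivative_in_subspace:
  fixes c :: "real \<Rightarrow> 'a::euclidean_space"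
  assumes "(c has_vector_derivative w) (at 0)" "subspace S"
    and "eventually (\<lambda>t. c t \<in> S) (nhds 0)"
  shows "w \<in> S"
proof -
  have "((\<lambda>t. (c t - c 0) /\<^sub>R t) \<longlongrightarrow> w) (at 0)"
  proof -
    have "((\<lambda>t. norm (c t - c 0 - t *\<^sub>R w) / norm t) \<longlongrightarrow> 0) (at 0)"
      using assms(1) by (simp add: has_vector_derivative_def has_derivative_iff_norm)
    moreover have "eventually (\<lambda>t. norm (c t - c 0 - t *\<^sub>R w) / norm t
        = norm ((c t - c 0) /\<^sub>R t - w)) (at 0)"
    proof (rule eventually_at_filter[THEN iffD2, OF always_eventually], clarify)
      fix t :: real assume "t \<noteq> 0"
      then have "c t - c 0 - t *\<^sub>R w = t *\<^sub>R ((c t - c 0) /\<^sub>R t - w)"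
        by (simp add: scaleR_right_diff_distrib)
      then have "norm (c t - c 0 - t *\<^sub>R w) = \<bar>t\<bar> * norm ((c t - c 0) /\<^sub>R t - w)"
        by (metis norm_scaleR)
      then show "norm (c t - c 0 - t *\<^sub>R w) / norm t = norm ((c t - c 0) /\<^sub>R t - w)"
        using \<open>t \<noteq> 0\<close> by simp
    qed
    ultimately have "((\<lambda>t. norm ((c t - c 0) /\<^sub>R t - w)) \<longlongrightarrow> 0) (at 0)"
      by (rule Lim_transform_eventually)
    then show ?thesis by (simp add: tendsto_norm_zero_iff LIM_zero_iff)
  qed
  moreover have "eventually (\<lambda>t. (c t - c 0) /\<^sub>R t \<in> S) (at 0)"
  proof -
    have "c 0 \<in> S" using assms(3) by (rule eventually_nhds_x_imp_x)
    moreover have "eventually (\<lambda>t. c t \<in> S) (at 0)"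
      using assms(3) by (simp add: eventually_nhds_conv_at)
    ultimately show ?thesis
      by (auto elim!: eventually_mono intro!: subspace_scale[OF assms(2)]
            subspace_diff[OF assms(2)])
  qed
  ultimately show ?thesis
    using closed_subspace[OF assms(2)] Lim_in_closed_set[of S _ "at (0::real)"] by simp
qed

section \<open>Tangent spaces\<close>

lemma curve_through_eventually:
  assumes "curve_through M p \<gamma> v" "open U" "p \<in> U"
  shows "eventually (\<lambda>t. \<gamma> t \<in> M \<inter> U) (nhds 0)"
proof -
  obtain \<epsilon> where e: "\<epsilon> > 0" "\<gamma> ` {-\<epsilon><..<\<epsilon>} \<subseteq> M" and p: "\<gamma> 0 = p"
    and D: "(\<gamma> has_vector_derivative v) (at 0)"
    using assms(1) unfolding curve_through_def by blast
  have "eventually (\<lambda>t. t \<in> {-\<epsilon><..<\<epsilon>}) (nhds 0)"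
    using e by (intro eventually_nhds_in_open) auto
  moreover have "(\<gamma> \<longlongrightarrow> \<gamma> 0) (nhds 0)"
    using has_vector_derivative_continuous[OF D]
    by (simp add: continuous_at tendsto_at_iff_tendsto_nhds)
  then have "eventually (\<lambda>t. \<gamma> t \<in> U) (nhds 0)"
    using assms p by (auto intro: topological_tendstoD)
  ultimately show ?thesis
    by eventually_elim (use e(2) in blast)
qed

lemma subspace_tangent_space:
  assumes "submanifold k M" "p \<in> M"
  shows "subspace (tangent_space M p)"
proof -
  obtain U V and \<psi> \<phi> :: "'a \<Rightarrow> 'a" and S
    where U: "open U" "p \<in> U" and V: "open V" and h: "homeomorphism U V \<psi> \<phi>"
      and sm: "smooth_on U \<psi>" "smooth_on V \<phi>" and S: "subspace S"
      and im: "\<psi> ` (M \<inter> U) = V \<inter> S"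
    using bspec[OF assms(1)[unfolded submanifold_def] assms(2)] by (elim exE conjE) (rule that)
  define x where "x = \<psi> p"
  define D where "D = frechet_derivative \<phi> (at x)"
  have x: "x \<in> V" "x \<in> S" "\<phi> x = p"
    using im U h assms(2) by (auto simp: x_def homeomorphism_def)
  have D: "(\<phi> has_derivative D) (at x)"
    unfolding D_def using sm x by (intro smooth_on_has_derivative)
  have "D w \<in> tangent_space M p" if "w \<in> S" for w
  proof -
    \<comment> \<open>The line through \<open>x\<close> in direction \<open>w\<close> stays in
      \<open>S\<close> for all \<open>t\<close>, but in the chart range \<open>V\<close> only for
      small \<open>t\<close>.\<close>
    have "open ((\<lambda>t. x + t *\<^sub>R w) -` V)"
      by (intro open_vimage V continuous_intros)
    moreover have "0 \<in> (\<lambda>t. x + t *\<^sub>R w) -` V" using x by simp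
    ultimately obtain e where e: "e > 0" "ball 0 e \<subseteq> (\<lambda>t. x + t *\<^sub>R w) -` V"
      by (meson open_contains_ball)
    have inV: "x + t *\<^sub>R w \<in> V" if "t \<in> {-e<..<e}" for t
      using e that by (auto simp: subset_iff dist_real_def)
    have "smooth_on {-e<..<e} (\<lambda>t. \<phi> (x + t *\<^sub>R w))"
      unfolding smooth_on_def
      using sm(2) inV by (auto simp: smooth_on_def intro!: Ck_on_compose_line)
    moreover have "(\<lambda>t. \<phi> (x + t *\<^sub>R w)) ` {-e<..<e} \<subseteq> M"
    proof clarify
      fix t assume "t \<in> {-e<..<e}"
      then have "x + t *\<^sub>R w \<in> \<psi> ` (M \<inter> U)"
        unfolding im using inV S x \<open>w \<in> S\<close> by (auto intro!: subspace_add subspace_scale)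
      then show "\<phi> (x + t *\<^sub>R w) \<in> M"
        using h by (auto simp: homeomorphism_def)
    qed
    moreover have "((\<lambda>t. \<phi> (x + t *\<^sub>R w)) has_vector_derivative D w) (at 0)"
    proof (rule has_vector_derivative_compose_frechet[where D=D and c="\<lambda>t. x + t *\<^sub>R w"])
      show "((\<lambda>t. x + t *\<^sub>R w) has_vector_derivative w) (at 0)"
        by (auto intro!: derivative_eq_intros)
    qed (use D in simp)
    ultimately have "curve_through M p (\<lambda>t. \<phi> (x + t *\<^sub>R w)) (D w)"
      using e(1) x(3) unfolding curve_through_def by auto
    then show ?thesis unfolding tangent_space_def by blast
  qed
  moreover have "v \<in> D ` S" if v: "v \<in> tangent_space M p" for v
  proof -
    obtain \<gamma> where \<gamma>: "curve_through M p \<gamma> v"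
      using v unfolding tangent_space_def by blast
    have \<gamma>': "(\<gamma> has_vector_derivative v) (at 0)" "\<gamma> 0 = p"
      using \<gamma> unfolding curve_through_def by auto
    have ev: "eventually (\<lambda>t. \<gamma> t \<in> M \<inter> U) (nhds 0)"
      by (rule curve_through_eventually[OF \<gamma> U])
    \<comment> \<open>The preimage of \<open>v\<close> under \<open>D\<close> is the velocity of the
      curve seen in the chart; mapping it back by \<phi> recovers the curve near 0, and uniqueness
      of derivatives gives \<open>v = D w\<close>.\<close>
    define w where "w = frechet_derivative \<psi> (at p) v"
    have c: "((\<lambda>t. \<psi> (\<gamma> t)) has_vector_derivative w) (at 0)"
      unfolding w_def
      by (rule has_vector_derivative_compose_frechet[OF \<gamma>'(1)])
         (simp add: \<gamma>'(2) smooth_on_has_derivative[OF sm(1) U(2)])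
    have "eventually (\<lambda>t. \<psi> (\<gamma> t) \<in> S) (nhds 0)"
      using ev by (rule eventually_mono) (use im in blast)
    then have "w \<in> S" by (rule has_vector_derivative_in_subspace[OF c S])
    have "((\<lambda>t. \<phi> (\<psi> (\<gamma> t))) has_vector_derivative D w) (at 0)"
      by (rule has_vector_derivative_compose_frechet[OF c]) (use D \<gamma>'(2) x_def in simp)
    moreover have "eventually (\<lambda>t. \<phi> (\<psi> (\<gamma> t)) = \<gamma> t) (nhds 0)"
      using ev by (rule eventually_mono) (use h in \<open>auto simp: homeomorphism_def\<close>)
    ultimately have "(\<gamma> has_vector_derivative D w) (at 0)"
      using has_vector_derivative_cong_ev[where S=UNIV and x=0 and f="\<lambda>t. \<phi> (\<psi> (\<gamma> t))" and g=\<gamma>]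
      by (auto dest: eventually_nhds_x_imp_x)
    then have "v = D w" using \<gamma>'(1) by (rule vector_derivative_unique_at[rotated])
    then show ?thesis using \<open>w \<in> S\<close> by blast
  qed
  ultimately have "tangent_space M p = D ` S" by auto
  then show ?thesis
    using linear_subspace_image[OF has_derivative_linear[OF D] S] by simp
qed

section \<open>The gradient\<close>

lemma gradient_in_tangent_space:
  assumes M: "submanifold k M" "p \<in> M" and f: "smooth_fun_on M f"
  shows "gradient M f p \<in> tangent_space M p"
proof -
  let ?T = "tangent_space M p"
  let ?P = "\<lambda>w. w \<in> ?T \<and> (\<forall>\<gamma> v. curve_through M p \<gamma> v \<longrightarrow>
           ((\<lambda>t. f (\<gamma> t)) has_real_derivative (w \<bullet> v)) (at 0))"
  have T: "subspace ?T" by (rule subspace_tangent_space[OF M])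
  obtain U g where U: "open U" "p \<in> U" and g: "smooth_on U g"
    and fg: "\<And>x. x \<in> M \<inter> U \<Longrightarrow> f x = g x"
    using bspec[OF f[unfolded smooth_fun_on_def] M(2)] by (elim exE conjE) (rule that, assumption+, simp)
  define D where "D = frechet_derivative g (at p)"
  have D: "(g has_derivative D) (at p)"
    unfolding D_def by (rule smooth_on_has_derivative[OF g U(2)])
  \<comment> \<open>Curves in \<open>M\<close> see \<open>f\<close> only on \<open>M\<close>, where
    it agrees with \<open>g\<close> near \<open>p\<close>; hence the derivative of \<open>f\<close>
    along a curve depends on its velocity alone.\<close>
  have fD: "((\<lambda>t. f (\<gamma> t)) has_real_derivative D v) (at 0)" if \<gamma>: "curve_through M p \<gamma> v" for \<gamma> v
  proof -
    have \<gamma>': "(\<gamma> has_vector_derivative v) (at 0)" "\<gamma> 0 = p"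
      using \<gamma> unfolding curve_through_def by auto
    have ev: "eventually (\<lambda>t. f (\<gamma> t) = g (\<gamma> t)) (nhds 0)"
      using curve_through_eventually[OF \<gamma> U] by (rule eventually_mono) (rule fg)
    have "((\<lambda>t. g (\<gamma> t)) has_real_derivative D v) (at 0)"
      unfolding has_real_derivative_iff_has_vector_derivative
      by (rule has_vector_derivative_compose_frechet[OF \<gamma>'(1)]) (simp add: D \<gamma>'(2))
    then show ?thesis using ev by (simp add: DERIV_cong_ev)
  qed
  \<comment> \<open>\<open>adjoint D 1\<close> is the ambient gradient of the local extension
    \<open>g\<close>. Its tangential component \<open>u\<close> is the candidate, since
    \<open>z\<close> pairs to zero with tangent vectors.\<close>
  obtain u z where u: "u \<in> ?T" and z: "\<And>v. v \<in> ?T \<Longrightarrow> orthogonal z v"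
    and uz: "adjoint D 1 = u + z"
    using orthogonal_subspace_decomp_exists[of ?T "adjoint D 1"] T
    by (metis span_eq_iff)
  have Du: "D v = u \<bullet> v" if "v \<in> ?T" for v
  proof -
    have "D v = v \<bullet> adjoint D 1"
      using adjoint_works[OF has_derivative_linear[OF D], of v 1] by simp
    then show ?thesis
      using z[OF that] by (simp add: uz inner_add_right orthogonal_def inner_commute)
  qed
  have "((\<lambda>t. f (\<gamma> t)) has_real_derivative (u \<bullet> v)) (at 0)"
    if "curve_through M p \<gamma> v" for \<gamma> v
  proof -
    have "v \<in> ?T" using that unfolding tangent_space_def by blast
    then show ?thesis using fD[OF that] by (simp add: Du)
  qed
  then have "?P u" using u by blast
  moreover have "w = u" if "?P w" for w
  proof -
    \<comment> \<open>Each tangent \<open>v\<close> is the velocity of some curve, along which both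
      pairings equal the one derivative of \<open>f\<close>. Testing with the tangent vector
      \<open>w - u\<close> then forces equality, as the definite description in
      \<open>gradient\<close> requires.\<close>
    have "w \<bullet> v = u \<bullet> v" if "v \<in> ?T" for v
      using that \<open>?P w\<close> \<open>?P u\<close> unfolding tangent_space_def by (blast intro: DERIV_unique)
    from this[of "w - u"] have "(w - u) \<bullet> (w - u) = 0"
      using \<open>?P w\<close> u T by (simp add: subspace_diff inner_diff_left)
    then show ?thesis by simp
  qed
  ultimately have "?P (gradient M f p)"
    unfolding gradient_def by (rule theI)
  then show ?thesis by blast
qed

section \<open>Angles and the conclusion\<close>

lemma cos_vec_angle: "cos (vec_angle u v) = (u \<bullet> v) / (norm u * norm v)"
proof -
  have "\<bar>(u \<bullet> v) / (norm u * norm v)\<bar> \<le> 1"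
    \<comment> \<open>For a zero vector the quotient is 0 by the division convention, so the bound
      holds without a nonvanishing assumption.\<close>
    using Cauchy_Schwarz_ineq2[of u v] by (cases "u = 0 \<or> v = 0") (auto simp: abs_mult)
  then show ?thesis unfolding vec_angle_def by (intro cos_arccos) linarith+
qed

theorem theorem3p2:
  fixes M :: "(real ^ 'n) set" and d :: "real ^ 'n" and f :: "real ^ 'n \<Rightarrow> real"
    and k :: nat and \<theta> :: real and I :: "real set" and \<alpha> :: "real \<Rightarrow> real ^ 'n"
  assumes "eikonal_helix_submanifold k M d \<theta> f"
    and "helix_line M d \<theta> I \<alpha>"
  shows "eikonal_helix_curve M f I \<alpha>"
proof -
  let ?G = "gradient M f"
  have M: "submanifold k M" and d: "norm d = 1" and \<theta>: "0 < \<theta>" "\<theta> < pi / 2"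
    and f: "smooth_fun_on M f" and n: "(\<lambda>q. norm (?G q)) constant_on M"
    and a: "(\<lambda>q. vec_angle (?G q) d) constant_on M"
    using assms(1) unfolding eikonal_helix_submanifold_def helix_submanifold_def eikonal_def
    by auto
  obtain T \<xi> where dec: "helix_decomposition M d \<theta> T \<xi>" and \<alpha>: "smooth_curve_in M I \<alpha>"
    and D: "\<And>t. t \<in> I \<Longrightarrow> (\<alpha> has_vector_derivative T (\<alpha> t)) (at t)"
    using assms(2) unfolding helix_line_def integral_curve_def by auto
  have inM: "\<alpha> t \<in> M" if "t \<in> I" for t
    using \<alpha> that unfolding smooth_curve_in_def by auto
  have vd: "vector_derivative \<alpha> (at t) = T (\<alpha> t)" if "t \<in> I" for t
    using D[OF that] by (rule vector_derivative_at)
  have "cos \<theta> > 0" using \<theta> by (intro cos_gt_zero) auto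
  \<comment> \<open>Dividing by \<open>cos \<theta>\<close> turns the cosine of the angle with
    \<open>d\<close> into that of the angle with \<open>T q\<close>. At a zero gradient both cosines
    are 0, so the formula still holds and no case split is made.\<close>
  have ang: "vec_angle (?G q) (T q) = arccos (cos (vec_angle (?G q) d) / cos \<theta>)" if "q \<in> M" for q
  proof -
    have q: "norm (T q) = 1" "orthogonal (\<xi> q) (?G q)" "d = cos \<theta> *\<^sub>R T q + sin \<theta> *\<^sub>R \<xi> q"
      using dec that gradient_in_tangent_space[OF M that f]
      unfolding helix_decomposition_def by auto
    have "?G q \<bullet> d = cos \<theta> * (?G q \<bullet> T q)"
      by (subst q(3)) (use q(2) in \<open>simp add: inner_add_right orthogonal_def inner_commute\<close>)
    then show ?thesis
      using \<open>cos \<theta> > 0\<close> by (simp add: cos_vec_angle d) (simp add: vec_angle_def q(1))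
  qed
  obtain c where "\<And>q. q \<in> M \<Longrightarrow> vec_angle (?G q) d = c"
    using a unfolding constant_on_def by auto
  then have "(\<lambda>t. vec_angle (?G (\<alpha> t)) (vector_derivative \<alpha> (at t))) constant_on I"
    unfolding constant_on_def
    by (intro exI[of _ "arccos (cos c / cos \<theta>)"]) (simp add: vd ang inM)
  moreover have "(\<lambda>t. norm (?G (\<alpha> t))) constant_on I"
    using n inM unfolding constant_on_def by blast
  moreover have "norm (vector_derivative \<alpha> (at t)) = 1" if "t \<in> I" for t
    using dec inM[OF that] vd[OF that] unfolding helix_decomposition_def by simp
  ultimately show ?thesis using \<alpha> unfolding eikonal_helix_curve_def by blast
qed

end
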